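(* Let $n\ge 1$, $q\geq 2$, $d$ and $s$ be integers with $0\leq d\leq n(q-1)$ and $0\le s\leq \frac{n}{2}$. Let $\mathcal{V}\subseteq \{0,1,\ldots,q-1\}^n$ be a $d$-uniform tuple system such that $\mathcal{V}$ shatters no subset of $[n]$ of size $s+1$. Then $$|\mathcal{V}|\leq \sum_{i=0}^s (q-1)^{n-i}\left( {n \choose i}-{n \choose i-1}\right).$$
   Context: $[n]=\{1,\ldots,n\}$ and $(q)=\{0,1,\ldots,q-1\}$. A tuple system is a subset $\mathcal{V}\subseteq (q)^n$; a tuple $\mathbf v=(v_1,\ldots,v_n)$ is viewed as a function $[n]\to(q)$. $\mathcal{V}$ shatters $S\subseteq[n]$ if $\{\mathbf v|_S:\mathbf v\in\mathcal V\}$ is the set of all functions $S\to (q)$. $\mathcal V$ is $d$-uniform if $\sum_{i=1}^n v_i=d$ for every $(v_1,\ldots,v_n)\in\mathcal V$. Convention: ${n\choose -1}=0$. *)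

theory Defs
  imports Complex_Main "HOL-Library.FuncSet"
begin

text \<open>Tuples in \<open>(q)\<^sup>n\<close> are extensional functions from \<open>{1..n}\<close> to \<open>{0..<q}\<close>, so that
  distinct elements of a tuple system are distinct as tuples.\<close>

definition tuple_system :: "nat \<Rightarrow> nat \<Rightarrow> (nat \<Rightarrow> nat) set \<Rightarrow> bool" where
  "tuple_system n q V \<longleftrightarrow> V \<subseteq> {1..n} \<rightarrow>\<^sub>E {0..<q}"

definition shatters :: "nat \<Rightarrow> (nat \<Rightarrow> nat) set \<Rightarrow> nat set \<Rightarrow> bool" where
  "shatters q V S \<longleftrightarrow> (\<lambda>v. restrict v S) ` V = S \<rightarrow>\<^sub>E {0..<q}"

definition uniform_system :: "nat \<Rightarrow> nat \<Rightarrow> (nat \<Rightarrow> nat) set \<Rightarrow> bool" where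
  "uniform_system n d V \<longleftrightarrow> (\<forall>v\<in>V. (\<Sum>i=1..n. v i) = d)"

text \<open>Integer lower index, with the convention that the coefficient vanishes at \<open>-1\<close>.\<close>

definition binom :: "nat \<Rightarrow> int \<Rightarrow> int" where
  "binom n k = (if k < 0 then 0 else int (n choose nat k))"

end

theory Submission
  imports Defs
begin

text \<open>Write \<open>r = q - 1\<close>. To a weight \<open>f\<close> on \<open>V\<close> associate the moments
  \<open>L w = (\<Sum>v\<in>V. f v * (\<Prod>j. v j choose w j))\<close>, and call the coordinates with \<open>w j = r\<close> the level
  set of \<open>w\<close>. By uniformity \<open>L v = f v\<close> for \<open>v \<in> V\<close>, so \<open>f\<close> vanishes as soon as all its moments
  do. If \<open>V\<close> misses a pattern on every set of size \<open>s + 1\<close>, expanding the indicator of that pattern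
  in binomials reduces all moments to those with level set of size at most \<open>s\<close>. Multiplying by
  \<open>(\<Sum>j. v j) = d\<close> yields linear relations among moments with level sets of size \<open>i\<close> modulo smaller
  ones; they reduce everything further to level sets that are ballot sets, of which there are
  \<open>(n choose i) - (n choose (i - 1))\<close> of size \<open>i\<close>. Hence if \<open>V\<close> had more elements than there are
  such \<open>w\<close>, a nonzero \<open>f\<close> orthogonal to all of them would exist, a contradiction.\<close>

section \<open>Underdetermined homogeneous linear systems\<close>

text \<open>Gaussian elimination, one equation and one unknown at a time. The coefficients
  \<open>a\<close> vary in the induction because elimination changes the remaining rows.\<close>

lemma homogeneous_system_nontrivial_solution:
  fixes a :: "'m \<Rightarrow> 'v \<Rightarrow> 'k::field"
  assumes "finite M" "finite V" "card M < card V"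
  shows "\<exists>f. (\<exists>v\<in>V. f v \<noteq> 0) \<and> (\<forall>m\<in>M. (\<Sum>v\<in>V. f v * a m v) = 0)"
  using assms
proof (induction M arbitrary: V a rule: finite_induct)
  case empty
  then have "V \<noteq> {}" by auto
  then show ?case by (intro exI[of _ "\<lambda>_. 1"]) auto
next
  case (insert m M)
  show ?case
  proof (cases "\<exists>v0\<in>V. a m v0 \<noteq> 0")
    case False
    obtain f where "\<exists>v\<in>V. f v \<noteq> 0" "\<forall>m\<in>M. (\<Sum>v\<in>V. f v * a m v) = 0"
      using insert.IH[of V a] insert.hyps insert.prems by auto
    with False show ?thesis by (intro exI[of _ f]) auto
  next
    case True
    then obtain v0 where v0: "v0 \<in> V" "a m v0 \<noteq> 0" by blast
    define V' where "V' = V - {v0}"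
    have V': "finite V'" "v0 \<notin> V'" "V = insert v0 V'" "card M < card V'"
      using insert v0 by (auto simp: V'_def)
    \<comment> \<open>Row \<open>m'\<close> minus the multiple of row \<open>m\<close> that clears
      column \<open>v0\<close>.\<close>
    define b where "b m' v = a m' v - a m' v0 * a m v / a m v0" for m' v
    obtain f where f: "\<exists>v\<in>V'. f v \<noteq> 0" "\<forall>m'\<in>M. (\<Sum>v\<in>V'. f v * b m' v) = 0"
      using insert.IH[of V' b] V' by auto
    \<comment> \<open>The value at \<open>v0\<close> that equation \<open>m\<close> forces, given
      \<open>f\<close> on \<open>V'\<close>.\<close>
    define c where "c = - (\<Sum>v\<in>V'. f v * a m v) / a m v0"
    have split: "(\<Sum>v\<in>V. (f(v0 := c)) v * a m' v) = c * a m' v0 + (\<Sum>v\<in>V'. f v * a m' v)" for m'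
    proof -
      have "(\<Sum>v\<in>V'. (f(v0 := c)) v * a m' v) = (\<Sum>v\<in>V'. f v * a m' v)"
        using V' by (intro sum.cong) auto
      then show ?thesis using V' by simp
    qed
    have "(\<Sum>v\<in>V. (f(v0 := c)) v * a m v) = 0"
      unfolding split using v0 by (simp add: c_def)
    moreover have "(\<Sum>v\<in>V. (f(v0 := c)) v * a m' v) = 0" if "m' \<in> M" for m'
    proof -
      have "0 = (\<Sum>v\<in>V'. f v * b m' v)" using f that by simp
      also have "\<dots> = (\<Sum>v\<in>V'. f v * a m' v - (f v * a m v) * (a m' v0 / a m v0))"
        by (intro sum.cong) (auto simp: b_def algebra_simps)
      also have "\<dots> = (\<Sum>v\<in>V'. f v * a m' v) + c * a m' v0"
        unfolding sum_subtractf sum_distrib_right[symmetric] by (simp add: c_def)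
      finally show ?thesis unfolding split by (simp add: add.commute)
    qed
    moreover have "\<exists>v\<in>V. (f(v0 := c)) v \<noteq> 0" using f V' by auto
    ultimately show ?thesis by (intro exI[of _ "f(v0 := c)"]) auto
  qed
qed

section \<open>Harmonic functions on the subsets of fixed size\<close>

text \<open>This is the kernel of the down operator from \<open>i\<close>-subsets of
  \<open>W\<close> to subsets one smaller. Writing \<open>Suc (card U) = i\<close> makes the
  condition vacuous for \<open>i = 0\<close>.\<close>

definition harmonic :: "nat \<Rightarrow> 'a set \<Rightarrow> ('a set \<Rightarrow> real) \<Rightarrow> bool" where
  "harmonic i W g \<longleftrightarrow>
    (\<forall>U\<subseteq>W. Suc (card U) = i \<longrightarrow> (\<Sum>j\<in>W - U. g (insert j U)) = 0)"

text \<open>Induction from \<open>card A = i - 1\<close> downwards. Adding up the vanishing sums for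
  all \<open>insert j A\<close> counts every \<open>T\<close> exactly \<open>i - card A\<close>
  times, a positive factor that can be cancelled.\<close>

lemma harmonic_sum_supersets:
  assumes "finite W" "harmonic i W g" "A \<subseteq> W" "card A < i"
  shows "(\<Sum>T | A \<subseteq> T \<and> T \<subseteq> W \<and> card T = i. g T) = 0"
  using assms(3,4)
proof (induction "i - Suc (card A)" arbitrary: A)
  case 0
  have fA: "finite A" using 0 assms(1) finite_subset by blast
  have i: "Suc (card A) = i" using 0 by simp
  have "bij_betw (\<lambda>j. insert j A) (W - A) {T. A \<subseteq> T \<and> T \<subseteq> W \<and> card T = i}"
    unfolding bij_betw_def
  proof
    show "inj_on (\<lambda>j. insert j A) (W - A)" by (auto simp: inj_on_def)
    show "(\<lambda>j. insert j A) ` (W - A) = {T. A \<subseteq> T \<and> T \<subseteq> W \<and> card T = i}"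
    proof (intro equalityI subsetI)
      fix T assume "T \<in> {T. A \<subseteq> T \<and> T \<subseteq> W \<and> card T = i}"
      then have T: "A \<subseteq> T" "T \<subseteq> W" "card T = i" by auto
      then have "card (T - A) = 1" using i fA by (simp add: card_Diff_subset)
      then obtain j where "T - A = {j}" by (auto simp: card_1_singleton_iff)
      then have "T = insert j A" "j \<in> W - A" using T by auto
      then show "T \<in> (\<lambda>j. insert j A) ` (W - A)" by blast
    qed (use fA i 0 in auto)
  qed
  then have "(\<Sum>T | A \<subseteq> T \<and> T \<subseteq> W \<and> card T = i. g T) = (\<Sum>j\<in>W - A. g (insert j A))"
    by (rule sum.reindex_bij_betw[symmetric])
  then show ?case using assms(2) 0 i by (auto simp: harmonic_def)
next
  case (Suc k)
  have fA: "finite A" using Suc assms(1) finite_subset by blast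
  define S where "S = {T. A \<subseteq> T \<and> T \<subseteq> W \<and> card T = i}"
  have fS: "finite S" using assms(1) by (auto simp: S_def intro: finite_subset[of _ "Pow W"])
  have "0 = (\<Sum>j\<in>W - A. \<Sum>T | insert j A \<subseteq> T \<and> T \<subseteq> W \<and> card T = i. g T)"
    using Suc fA by (intro sum.neutral[symmetric] ballI Suc.hyps(1)) auto
  also have "\<dots> = (\<Sum>j\<in>W - A. \<Sum>T | T \<in> S \<and> j \<in> T. g T)"
    by (intro sum.cong) (auto simp: S_def)
  also have "\<dots> = (\<Sum>T\<in>S. \<Sum>j | j \<in> W - A \<and> j \<in> T. g T)"
    using fS assms(1) by (intro sum.swap_restrict) auto
  also have "\<dots> = (\<Sum>T\<in>S. real (i - card A) * g T)"
  proof (intro sum.cong refl)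
    fix T assume "T \<in> S"
    then have "{j. j \<in> W - A \<and> j \<in> T} = T - A" "A \<subseteq> T" "card T = i" by (auto simp: S_def)
    then show "(\<Sum>j | j \<in> W - A \<and> j \<in> T. g T) = real (i - card A) * g T"
      using fA by (simp add: card_Diff_subset)
  qed
  finally have "real (i - card A) * (\<Sum>T\<in>S. g T) = 0" by (simp add: sum_distrib_left)
  then show ?case using Suc by (simp add: S_def)
qed

text \<open>Inclusion-exclusion on one element \<open>b\<close> at a time: the sets avoiding
  \<open>insert b B\<close> are those avoiding \<open>B\<close> minus those that also contain
  \<open>b\<close>. In the latter, \<open>b\<close> moves to \<open>E\<close>, so the size condition
  survives.\<close>

lemma harmonic_sum_supersets_avoiding:
  assumes "finite W" "harmonic i W g" "finite B" "B \<subseteq> W" "E \<subseteq> W" "card E + card B < i"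
  shows "(\<Sum>T | E \<subseteq> T \<and> T \<inter> B = {} \<and> T \<subseteq> W \<and> card T = i. g T) = 0"
  using assms(3-)
proof (induction B arbitrary: E rule: finite_induct)
  case empty
  then show ?case using harmonic_sum_supersets[OF assms(1,2), of E] by simp
next
  case (insert b B)
  have fE: "finite E" using insert assms(1) finite_subset by blast
  let ?S = "\<lambda>E B. {T. E \<subseteq> T \<and> T \<inter> B = {} \<and> T \<subseteq> W \<and> card T = i}"
  have fin: "finite (?S E' B')" for E' B'
    using assms(1) by (auto intro: finite_subset[of _ "Pow W"])
  have "sum g (?S E B) = sum g (?S E (insert b B)) + sum g (?S (insert b E) B)"
    using fin[of E "insert b B"] fin[of "insert b E" B]
    by (subst sum.union_disjoint[symmetric]) (auto intro!: sum.cong)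
  moreover have "sum g (?S E B) = 0" using insert by (intro insert.IH) auto
  moreover have "sum g (?S (insert b E) B) = 0"
    using insert fE card_insert_le_m1 by (intro insert.IH) (auto simp: card_insert_if)
  ultimately show ?case by simp
qed

section \<open>Ballot sets and straightening\<close>

text \<open>In every prefix the elements of \<open>T\<close> are at most as many as the others; such
  sets of size \<open>i\<close> are the second rows of standard Young tableaux of shape
  \<open>(n - i, i)\<close>.\<close>

definition ballot :: "nat \<Rightarrow> nat set \<Rightarrow> bool" where
  "ballot n T \<longleftrightarrow> T \<subseteq> {1..n} \<and> (\<forall>k\<le>n. 2 * card (T \<inter> {1..k}) \<le> k)"

text \<open>Straightening: if the prefix \<open>{1..k}\<close> witnesses that \<open>T\<close> is not a ballot set, the sum over
  the sets that avoid \<open>{1..k} - T\<close> and contain \<open>T - {1..k}\<close> vanishes, and each such set other than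
  \<open>T\<close> arises from \<open>T\<close> by moving elements beyond \<open>k\<close>.\<close>

lemma harmonic_eq_0_if_ballot_eq_0:
  assumes W: "W \<subseteq> {1..n}" and h: "harmonic i W g"
    and g0: "\<And>T. T \<subseteq> W \<Longrightarrow> card T = i \<Longrightarrow> ballot n T \<Longrightarrow> g T = 0"
    and "T \<subseteq> W" "card T = i"
  shows "g T = 0"
  using assms(4,5)
\<comment> \<open>Straightening moves elements to the right, which lowers this measure.\<close>
proof (induction "\<Sum>j\<in>T. n - j" arbitrary: T rule: less_induct)
  case less
  have fW: "finite W" using W finite_subset by blast
  have fT: "finite T" using less.prems fW finite_subset by blast
  show ?case
  proof (cases "ballot n T")
    case True
    then show ?thesis using g0 less.prems by simp
  next
    case False
    then obtain k where k: "k \<le> n" "k < 2 * card (T \<inter> {1..k})"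
      using less.prems W by (auto simp: ballot_def not_le)
    define B where "B = W \<inter> {1..k} - T"
    define E where "E = T - {1..k}"
    define S where "S = {T'. E \<subseteq> T' \<and> T' \<inter> B = {} \<and> T' \<subseteq> W \<and> card T' = i}"
    have fS: "finite S" using fW by (auto simp: S_def intro: finite_subset[of _ "Pow W"])
    have TS: "T \<in> S" using less.prems by (auto simp: S_def E_def B_def)
    \<comment> \<open>Violation of the ballot condition at \<open>k\<close> means that the prefix
      has fewer elements outside \<open>T\<close> than inside, which is exactly the size condition
      for the vanishing sum.\<close>
    have "card B \<le> card ({1..k} - T \<inter> {1..k})"
      by (intro card_mono) (auto simp: B_def)
    also have "\<dots> = k - card (T \<inter> {1..k})" by (subst card_Diff_subset) auto
    finally have "card B < card (T \<inter> {1..k})" using k by linarith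
    moreover have "card E + card (T \<inter> {1..k}) = i"
      using less.prems fT card_Int_Diff[of T "{1..k}"] by (simp add: E_def)
    ultimately have "card E + card B < i" by linarith
    then have "sum g S = 0"
      unfolding S_def using less.prems fW
      by (intro harmonic_sum_supersets_avoiding[OF fW h]) (auto simp: B_def E_def)
    moreover have "g T' = 0" if T': "T' \<in> S - {T}" for T'
    proof (rule less.hyps)
      show "T' \<subseteq> W" "card T' = i" using T' by (auto simp: S_def)
      have fT': "finite T'" using T' fW finite_subset by (auto simp: S_def)
      define D where "D = T - T'"
      define D' where "D' = T' - T"
      have fD: "finite D" "finite D'" using fT fT' by (auto simp: D_def D'_def)
      have "D \<subseteq> T \<inter> {1..k}" using T' by (auto simp: D_def S_def E_def)
      moreover have "D' \<subseteq> {1..n} - {1..k}" using T' W by (auto simp: D'_def S_def B_def)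
      ultimately have D: "D \<subseteq> {1..k}" "D' \<subseteq> {k<..n}" by auto
      have "card T = card (T \<inter> T') + card D" "card T' = card (T \<inter> T') + card D'"
        using card_Int_Diff[OF fT, of T'] card_Int_Diff[OF fT', of T]
        by (simp_all add: D_def D'_def Int_commute)
      then have cD: "card D = card D'" using T' less.prems by (simp add: S_def)
      have "D' \<noteq> {}"
      proof
        assume "D' = {}"
        then have "D = {}" "D' = {}" using cD fD by auto
        then show False using T' by (auto simp: D_def D'_def)
      qed
      \<comment> \<open>\<open>D\<close> and \<open>D'\<close> have equal size and lie on opposite
        sides of the cut at \<open>k\<close>, so \<open>n - k\<close> separates their
        contributions.\<close>
      then have "(\<Sum>j\<in>D'. n - j) < (\<Sum>j\<in>D'. n - k)"
        using fD D by (intro sum_strict_mono) (auto simp: subset_iff)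
      also have "\<dots> = (\<Sum>j\<in>D. n - k)" by (simp add: cD)
      also have "\<dots> \<le> (\<Sum>j\<in>D. n - j)" using D by (intro sum_mono diff_le_mono2) auto
      finally have "(\<Sum>j\<in>D'. n - j) < (\<Sum>j\<in>D. n - j)" .
      moreover have "(\<Sum>j\<in>T. n - j) = (\<Sum>j\<in>T \<inter> T'. n - j) + (\<Sum>j\<in>D. n - j)"
        unfolding D_def using fT by (rule sum.Int_Diff)
      moreover have "(\<Sum>j\<in>T'. n - j) = (\<Sum>j\<in>T \<inter> T'. n - j) + (\<Sum>j\<in>D'. n - j)"
        unfolding D'_def using sum.Int_Diff[OF fT', of "\<lambda>j. n - j" T] by (simp add: Int_commute)
      ultimately show "(\<Sum>j\<in>T'. n - j) < (\<Sum>j\<in>T. n - j)" by linarith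
    qed
    then have "sum g (S - {T}) = 0" by (intro sum.neutral) auto
    ultimately show ?thesis using sum.remove[OF fS TS, of g] by simp
  qed
qed

section \<open>Counting ballot sets\<close>

definition ballot_sets :: "nat \<Rightarrow> nat \<Rightarrow> nat set set" where
  "ballot_sets n i = {T. ballot n T \<and> card T = i}"

lemma finite_ballot_sets: "finite (ballot_sets n i)"
  by (rule finite_subset[of _ "Pow {1..n}"]) (auto simp: ballot_sets_def ballot_def)

lemma ballot_imp_card_le: "ballot n T \<Longrightarrow> 2 * card T \<le> n"
  by (auto simp: ballot_def Int_absorb2)

lemma ballot_prefix: "ballot (Suc n) T \<Longrightarrow> ballot n (T \<inter> {1..n})"
  unfolding ballot_def
proof (intro conjI allI impI)
  fix k assume T: "T \<subseteq> {1..Suc n} \<and> (\<forall>k\<le>Suc n. 2 * card (T \<inter> {1..k}) \<le> k)" and "k \<le> n"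
  then have "T \<inter> {1..n} \<inter> {1..k} = T \<inter> {1..k}" by auto
  then show "2 * card (T \<inter> {1..n} \<inter> {1..k}) \<le> k" using T \<open>k \<le> n\<close> by auto
qed auto

lemma binom_Suc: "binom (Suc n) (int i) = binom n (int i) + binom n (int i - 1)"
  by (cases i) (auto simp: binom_def nat_add_distrib)

text \<open>Deleting the last point gives a recursion that matches Pascal's rule. The range extends
  to \<open>2 * i = Suc n\<close>, one step beyond the possible sizes, so that the induction
  hypothesis covers every \<open>i\<close> that arises.\<close>

lemma card_ballot_sets_le:
  assumes "2 * i \<le> Suc n"
  shows "int (card (ballot_sets n i)) \<le> binom n (int i) - binom n (int i - 1)"
  using assms
proof (induction n arbitrary: i)
  case 0
  then have "i = 0" by simp
  moreover have "ballot_sets 0 0 = {{}}" by (auto simp: ballot_sets_def ballot_def)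
  ultimately show ?case by (simp add: binom_def)
next
  case (Suc n)
  show ?case
  proof (cases "2 * i = Suc (Suc n)")
    case True
    \<comment> \<open>In this boundary case both sides are zero: no ballot set is that large, and
      the two binomials agree by symmetry.\<close>
    have "ballot_sets (Suc n) i = {}" using ballot_imp_card_le True by (fastforce simp: ballot_sets_def)
    moreover obtain i' where i': "i = Suc i'" using True by (cases i) auto
    moreover have "Suc n choose Suc i' = Suc n choose i'"
      using True i' binomial_symmetric[of "Suc i'" "Suc n"] by (auto simp: algebra_simps)
    ultimately show ?thesis by (simp add: binom_def nat_add_distrib)
  next
    case False
    then have i: "2 * i \<le> Suc n" using Suc.prems by simp
    show ?thesis
    proof (cases i)
      case 0
      have "ballot_sets (Suc n) 0 \<subseteq> {{}}"
        by (auto simp: ballot_sets_def ballot_def dest: finite_subset)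
      then have "card (ballot_sets (Suc n) 0) \<le> card {{} :: nat set}" by (intro card_mono) auto
      then show ?thesis using 0 by (simp add: binom_def)
    next
      case (Suc i')
      have "ballot_sets (Suc n) i \<subseteq> ballot_sets n i \<union> insert (Suc n) ` ballot_sets n i'"
      proof
        fix T assume "T \<in> ballot_sets (Suc n) i"
        then have T: "ballot (Suc n) T" "card T = i" "T \<subseteq> {1..Suc n}"
          by (auto simp: ballot_sets_def ballot_def)
        have fT: "finite T" using T finite_subset by blast
        note b = ballot_prefix[OF T(1)]
        show "T \<in> ballot_sets n i \<union> insert (Suc n) ` ballot_sets n i'"
        proof (cases "Suc n \<in> T")
          case True
          then have eq: "T = insert (Suc n) (T \<inter> {1..n})" using T by (auto simp: le_Suc_eq)
          have "card T = Suc (card (T \<inter> {1..n}))" by (subst eq) auto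
          then have "T \<inter> {1..n} \<in> ballot_sets n i'" using b T Suc by (simp add: ballot_sets_def)
          with eq show ?thesis by blast
        next
          case False
          then have "T \<inter> {1..n} = T" using T by (fastforce simp: le_Suc_eq)
          with b T show ?thesis by (simp add: ballot_sets_def)
        qed
      qed
      then have "card (ballot_sets (Suc n) i)
          \<le> card (ballot_sets n i \<union> insert (Suc n) ` ballot_sets n i')"
        by (intro card_mono) (auto simp: finite_ballot_sets)
      also have "\<dots> \<le> card (ballot_sets n i) + card (insert (Suc n) ` ballot_sets n i')"
        by (rule card_Un_le)
      also have "\<dots> \<le> card (ballot_sets n i) + card (ballot_sets n i')"
        by (simp add: card_image_le finite_ballot_sets)
      finally have "int (card (ballot_sets (Suc n) i))
          \<le> int (card (ballot_sets n i)) + int (card (ballot_sets n i'))" by linarith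
      also have "\<dots> \<le> (binom n (int i) - binom n (int i - 1)) + (binom n (int i') - binom n (int i' - 1))"
        using Suc.IH[of i] Suc.IH[of i'] i Suc by linarith
      also have "\<dots> = binom (Suc n) (int i) - binom (Suc n) (int i')"
        unfolding binom_Suc using Suc by simp
      finally show ?thesis using Suc by simp
    qed
  qed
qed

section \<open>Binomial moments of a weight\<close>

text \<open>Binomials instead of powers make the product vanish unless \<open>w\<close> lies below
  \<open>v\<close> on all of \<open>{1..n}\<close>.\<close>

definition moment :: "nat \<Rightarrow> (nat \<Rightarrow> nat) set \<Rightarrow> ((nat \<Rightarrow> nat) \<Rightarrow> real) \<Rightarrow> (nat \<Rightarrow> nat) \<Rightarrow> real" where
  "moment n V f w = (\<Sum>v\<in>V. f v * (\<Prod>j=1..n. real (v j choose w j)))"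

definition level :: "nat \<Rightarrow> nat \<Rightarrow> (nat \<Rightarrow> nat) \<Rightarrow> nat set" where
  "level n r w = {j\<in>{1..n}. w j = r}"

lemma finite_level [simp]: "finite (level n r w)"
  by (simp add: level_def)

lemma moment_cong: "(\<And>j. j \<in> {1..n} \<Longrightarrow> w j = w' j) \<Longrightarrow> moment n V f w = moment n V f w'"
  by (auto simp: moment_def intro!: sum.cong prod.cong)

lemma tuple_system_less: "tuple_system n q V \<Longrightarrow> v \<in> V \<Longrightarrow> j \<in> {1..n} \<Longrightarrow> v j < q"
  by (auto simp: tuple_system_def dest!: subsetD PiE_mem)

text \<open>A nonzero product forces \<open>v0\<close> below \<open>v\<close> coordinatewise, and
  equal coordinate sums then force \<open>v = v0\<close>. The one surviving product is 1.\<close>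

lemma moment_self:
  assumes "finite V" "tuple_system n q V" "uniform_system n d V" "v0 \<in> V"
  shows "moment n V f v0 = f v0"
proof -
  have "(\<Prod>j=1..n. real (v j choose v0 j)) = 0" if v: "v \<in> V - {v0}" for v
  proof (rule ccontr)
    assume nz: "(\<Prod>j=1..n. real (v j choose v0 j)) \<noteq> 0"
    then have le: "v0 j \<le> v j" if "j \<in> {1..n}" for j
      using that by (auto simp: binomial_eq_0_iff not_less)
    have "sum v {1..n} = sum v0 {1..n}" using assms v by (simp add: uniform_system_def)
    then have "v j = v0 j" if "j \<in> {1..n}" for j
      using that le sum_mono_inv[of v0 "{1..n}" v j] by auto
    then have "v = v0"
      using assms v by (intro PiE_ext[of _ "{1..n}" "\<lambda>_. {0..<q}"]) (auto simp: tuple_system_def)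
    then show False using v by simp
  qed
  then have "(\<Sum>v\<in>V - {v0}. f v * (\<Prod>j=1..n. real (v j choose v0 j))) = 0"
    by (intro sum.neutral) auto
  then show ?thesis
    unfolding moment_def using assms by (simp add: sum.remove[of V v0])
qed

lemma times_binomial: "real x * real (x choose k) = real k * real (x choose k) + real (Suc k) * real (x choose Suc k)"
proof (cases "k \<le> x")
  case True
  have "Suc k * (x choose Suc k) = (x - k) * (x choose k)"
    using binomial_absorb_comp[of x k] binomial_absorption[of k x] by (cases x) (auto simp: algebra_simps)
  then have "real (Suc k) * real (x choose Suc k) = (real x - real k) * real (x choose k)"
    using True by (metis of_nat_diff of_nat_mult)
  then show ?thesis by (simp add: algebra_simps)
qed (simp add: binomial_eq_0)

text \<open>On \<open>V\<close> the factor \<open>d\<close> is the sum of the \<open>v j\<close>;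
  each \<open>v j\<close> is absorbed into the binomial of its own coordinate by
  \<open>times_binomial\<close>.\<close>

lemma moment_uniform:
  assumes "uniform_system n d V"
  shows "real d * moment n V f w = (\<Sum>j=1..n. real (w j) * moment n V f w
    + real (Suc (w j)) * moment n V f (w(j := Suc (w j))))"
proof -
  let ?P = "\<lambda>v w. \<Prod>j=1..n. real (v j choose w j)"
  have P: "real (v j) * ?P v w = real (w j) * ?P v w + real (Suc (w j)) * ?P v (w(j := Suc (w j)))"
    if j: "j \<in> {1..n}" for v j
  proof -
    let ?R = "\<Prod>k\<in>{1..n} - {j}. real (v k choose w k)"
    have 1: "?P v w = real (v j choose w j) * ?R" using j by (simp add: prod.remove)
    have "?P v (w(j := Suc (w j))) = real (v j choose Suc (w j))
        * (\<Prod>k\<in>{1..n} - {j}. real (v k choose (w(j := Suc (w j))) k))"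
      using j by (simp add: prod.remove)
    also have "(\<Prod>k\<in>{1..n} - {j}. real (v k choose (w(j := Suc (w j))) k)) = ?R"
      by (intro prod.cong) auto
    finally have 2: "?P v (w(j := Suc (w j))) = real (v j choose Suc (w j)) * ?R" .
    have "real (v j) * ?P v w = (real (v j) * real (v j choose w j)) * ?R" unfolding 1 by simp
    then show ?thesis unfolding 1 2 times_binomial by (simp add: algebra_simps)
  qed
  have "real d * moment n V f w = (\<Sum>v\<in>V. f v * (real (\<Sum>j=1..n. v j) * ?P v w))"
    unfolding moment_def sum_distrib_left using assms
    by (intro sum.cong) (auto simp: uniform_system_def)
  also have "\<dots> = (\<Sum>v\<in>V. \<Sum>j=1..n. f v * (real (v j) * ?P v w))"
    by (simp add: sum_distrib_left sum_distrib_right)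
  also have "\<dots> = (\<Sum>j=1..n. \<Sum>v\<in>V. f v * (real (v j) * ?P v w))" by (rule sum.swap)
  also have "\<dots> = (\<Sum>j=1..n. \<Sum>v\<in>V. real (w j) * (f v * ?P v w)
      + real (Suc (w j)) * (f v * ?P v (w(j := Suc (w j)))))"
    by (intro sum.cong refl) (simp only: P, simp add: algebra_simps)
  also have "\<dots> = (\<Sum>j=1..n. real (w j) * moment n V f w
    + real (Suc (w j)) * moment n V f (w(j := Suc (w j))))"
    unfolding moment_def by (simp only: sum.distrib sum_distrib_left)
  finally show ?thesis .
qed

lemma moment_eq_0_if_exceeds:
  assumes "tuple_system n q V" "j \<in> {1..n}" "q \<le> w j"
  shows "moment n V f w = 0"
  unfolding moment_def
proof (intro sum.neutral ballI)
  fix v assume "v \<in> V"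
  then have "v j < w j" using tuple_system_less[OF assms(1) _ assms(2)] assms(3) by fastforce
  then show "f v * (\<Prod>j=1..n. real (v j choose w j)) = 0"
    using assms(2) by (auto simp: binomial_eq_0_iff)
qed

section \<open>Reduction to ballot level sets\<close>

text \<open>Vary which of the coordinates with value \<open>r - 1\<close> or \<open>r\<close> carry
  \<open>r\<close>. Modulo moments with smaller level sets, which vanish by induction, the moment is
  harmonic in the level set, so straightening applies.\<close>

lemma moment_eq_0_if_ballot:
  assumes V: "tuple_system n (Suc r) V" "uniform_system n d V" and r: "r \<ge> 1"
    and ballot: "\<And>w. (\<forall>j\<in>{1..n}. w j \<le> r) \<Longrightarrow> card (level n r w) \<le> s \<Longrightarrow>
      ballot n (level n r w) \<Longrightarrow> moment n V f w = 0"
    and w: "\<forall>j\<in>{1..n}. w j \<le> r" "card (level n r w) \<le> s"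
  shows "moment n V f w = 0"
  using w
proof (induction "card (level n r w)" arbitrary: w rule: less_induct)
  case less
  let ?m = "moment n V f"
  define i where "i = card (level n r w)"
  define W where "W = {j\<in>{1..n}. w j \<ge> r - 1}"
  define x where "x T = (\<lambda>j. if j \<in> T then r else if j \<in> W then r - 1 else w j)" for T
  have xr: "\<forall>j\<in>{1..n}. x T j \<le> r" for T using less.prems r by (auto simp: x_def)
  have lx: "level n r (x T) = T" if "T \<subseteq> W" for T
    using that r by (auto simp: level_def x_def W_def)
  have "harmonic i W (\<lambda>T. ?m (x T))"
    unfolding harmonic_def
  proof (intro allI impI)
    fix U assume U: "U \<subseteq> W" "Suc (card U) = i"
    have small: "?m y = 0" if "\<forall>j\<in>{1..n}. y j \<le> r" "card (level n r y) < i" for y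
      using that less.prems less.hyps[of y] by (auto simp: i_def)
    have mU: "?m (x U) = 0" using U by (intro small xr) (auto simp: lx)
    \<comment> \<open>Raising a coordinate in \<open>U\<close> exceeds \<open>r\<close>, and raising
      one outside \<open>W\<close> does not enlarge the level set; both give zero moments. Only
      \<open>W - U\<close> contributes, with the common factor \<open>r\<close>.\<close>
    have terms: "real (Suc (x U j)) * ?m ((x U)(j := Suc (x U j)))
        = (if j \<in> W - U then real r * ?m (x (insert j U)) else 0)" if j: "j \<in> {1..n}" for j
    proof -
      consider "j \<in> U" | "j \<in> W - U" | "j \<notin> W" using U by blast
      then show ?thesis
      proof cases
        case 1
        then have "?m ((x U)(j := Suc (x U j))) = 0"
          using j by (intro moment_eq_0_if_exceeds[OF V(1) j]) (auto simp: x_def)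
        then show ?thesis using 1 by simp
      next
        case 2
        then have "(x U)(j := Suc (x U j)) = x (insert j U)" "Suc (x U j) = r"
          using r by (auto simp: x_def)
        then show ?thesis using 2 by simp
      next
        case 3
        then have wj: "Suc (w j) < r" "x U j = w j" using j U by (auto simp: W_def x_def)
        have "level n r ((x U)(j := Suc (x U j))) \<subseteq> level n r (x U)"
          using wj by (auto simp: level_def)
        then have "card (level n r ((x U)(j := Suc (x U j)))) \<le> card (level n r (x U))"
          by (intro card_mono) auto
        then have "?m ((x U)(j := Suc (x U j))) = 0"
          using U wj xr by (intro small) (auto simp: lx)
        then show ?thesis using 3 by simp
      qed
    qed
    \<comment> \<open>The left side of \<open>moment_uniform\<close> and its unraised terms are
      multiples of the moment of \<open>x U\<close>, which is zero.\<close>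
    have "0 = (\<Sum>j=1..n. real (Suc (x U j)) * ?m ((x U)(j := Suc (x U j))))"
      using moment_uniform[OF V(2), of f "x U"] mU by simp
    also have "\<dots> = (\<Sum>j=1..n. if j \<in> W - U then real r * ?m (x (insert j U)) else 0)"
      by (intro sum.cong refl terms)
    also have "\<dots> = (\<Sum>j\<in>W - U. real r * ?m (x (insert j U)))"
      by (intro sum.mono_neutral_cong_right) (auto simp: W_def)
    finally show "(\<Sum>j\<in>W - U. ?m (x (insert j U))) = 0"
      using r by (simp add: sum_distrib_left[symmetric])
  qed
  then have "?m (x (level n r w)) = 0"
  proof (rule harmonic_eq_0_if_ballot_eq_0[rotated])
    show "?m (x T) = 0" if "T \<subseteq> W" "card T = i" "ballot n T" for T
      using that less.prems(2) by (intro ballot xr) (simp_all add: lx i_def)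
  qed (auto simp: level_def W_def i_def)
  moreover have "?m w = ?m (x (level n r w))"
  proof (rule moment_cong)
    fix j assume j: "j \<in> {1..n}"
    then have "w j \<le> r" using less.prems(1) by blast
    then show "w j = x (level n r w) j" using j by (auto simp: x_def level_def W_def)
  qed
  ultimately show ?case by simp
qed

section \<open>Reduction of large level sets through missed patterns\<close>

text \<open>Binomial inversion: \<open>choose_mult\<close> turns the sum into an alternating row sum
  for \<open>x - a\<close>, zero unless \<open>x = a\<close>. The exponent \<open>k + a\<close> has
  the parity of \<open>k - a\<close> without truncated subtraction.\<close>

lemma indicator_binomial_expansion:
  assumes "x \<le> r"
  shows "(\<Sum>k\<le>r. (-1) ^ (k + a) * real (k choose a) * real (x choose k)) = of_bool (x = a)"
proof (cases "a \<le> x")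
  case False
  have "(-1) ^ (k + a) * real (k choose a) * real (x choose k) = 0" for k
    using False by (cases "k < a") (auto simp: binomial_eq_0)
  then show ?thesis using False by (subst sum.neutral) auto
next
  case True
  have "(\<Sum>k\<le>r. (-1) ^ (k + a) * real (k choose a) * real (x choose k))
      = (\<Sum>k=a..x. (-1) ^ (k + a) * real (k choose a) * real (x choose k))"
    using assms by (intro sum.mono_neutral_right) (auto simp: not_le binomial_eq_0)
  also have "\<dots> = (\<Sum>k=a..x. real (x choose a) * ((-1) ^ (k - a) * real (x - a choose (k - a))))"
  proof (intro sum.cong refl)
    fix k assume k: "k \<in> {a..x}"
    then have "real (x choose k) * real (k choose a) = real (x choose a) * real (x - a choose (k - a))"
      using choose_mult[of a k x] by (metis atLeastAtMost_iff of_nat_mult)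
    moreover have "(-1::real) ^ (k + a) = (-1) ^ (k - a)"
      using k by (simp add: uminus_power_if)
    ultimately show "(-1) ^ (k + a) * real (k choose a) * real (x choose k)
        = real (x choose a) * ((-1) ^ (k - a) * real (x - a choose (k - a)))"
      by (simp add: algebra_simps)
  qed
  also have "\<dots> = real (x choose a) * (\<Sum>k\<le>x - a. (-1) ^ k * real (x - a choose k))"
    unfolding sum_distrib_left[symmetric] using True
    by (intro arg_cong2[where f = "(*)"] refl
          sum.reindex_bij_witness[of _ "\<lambda>k. k + a" "\<lambda>k. k - a"]) auto
  also have "\<dots> = of_bool (x = a)"
    using True choose_alternating_sum[of "x - a", where 'a = real] by (cases "x = a") auto
  finally show ?thesis .
qed

text \<open>The indicator of a missed pattern on \<open>s + 1\<close> coordinates of the level set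
  is zero on \<open>V\<close>. In its expansion the top term is a nonzero multiple of the given
  moment, and every other term has a smaller level set.\<close>

lemma moment_eq_0_if_not_shatters:
  assumes V: "tuple_system n (Suc r) V"
    and ns: "\<And>S. S \<subseteq> {1..n} \<Longrightarrow> card S = s + 1 \<Longrightarrow> \<not> shatters (Suc r) V S"
    and low: "\<And>w. (\<forall>j\<in>{1..n}. w j \<le> r) \<Longrightarrow> card (level n r w) \<le> s \<Longrightarrow> moment n V f w = 0"
    and w: "\<forall>j\<in>{1..n}. w j \<le> r"
  shows "moment n V f w = 0"
  using w
proof (induction "card (level n r w)" arbitrary: w rule: less_induct)
  case less
  let ?m = "moment n V f"
  show ?case
  proof (cases "card (level n r w) \<le> s")
    case True
    then show ?thesis using low less.prems by blast
  next
    case False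
    then obtain S where S: "S \<subseteq> level n r w" "card S = s + 1"
      by (metis Suc_eq_plus1 not_less_eq_eq obtain_subset_with_card_n)
    have Sn: "S \<subseteq> {1..n}" and fS: "finite S"
      using S finite_subset[OF S(1)] by (auto simp: level_def)
    have "(\<lambda>v. restrict v S) ` V \<subseteq> S \<rightarrow>\<^sub>E {0..<Suc r}"
      using V Sn by (fastforce simp: tuple_system_def)
    then obtain a where a: "a \<in> S \<rightarrow>\<^sub>E {0..<Suc r}" "a \<notin> (\<lambda>v. restrict v S) ` V"
      using ns[OF Sn S(2)] unfolding shatters_def by blast
    define c where "c j k = (-1) ^ (k + a j) * real (k choose a j)" for j k
    define y where "y h = (\<lambda>j. if j \<in> S then h j else w j)" for h
    define H where "H = (S \<rightarrow>\<^sub>E {..r})"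
    \<comment> \<open>The top exponent: as \<open>S\<close> lies in the level set of
      \<open>w\<close>, \<open>y h0\<close> agrees with \<open>w\<close> on
      \<open>{1..n}\<close>.\<close>
    define h0 where "h0 = restrict (\<lambda>_. r) S"
    have fH: "finite H" using fS by (auto simp: H_def intro: finite_PiE)
    have h0: "h0 \<in> H" by (auto simp: H_def h0_def)
    have split: "(\<Prod>j=1..n. F j) = (\<Prod>j\<in>S. F j) * (\<Prod>j\<in>{1..n} - S. F j)" for F :: "nat \<Rightarrow> real"
      using prod.subset_diff[OF Sn] by (simp add: mult.commute)
    have "(\<Sum>h\<in>H. (\<Prod>j\<in>S. c j (h j)) * (\<Prod>j=1..n. real (v j choose y h j))) = 0" if v: "v \<in> V" for v
    proof -
      let ?R = "\<Prod>j\<in>{1..n} - S. real (v j choose w j)"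
      have "(\<Prod>j=1..n. real (v j choose y h j)) = (\<Prod>j\<in>S. real (v j choose h j)) * ?R" for h
        unfolding split by (intro arg_cong2[where f = "(*)"] prod.cong) (auto simp: y_def)
      then have "(\<Sum>h\<in>H. (\<Prod>j\<in>S. c j (h j)) * (\<Prod>j=1..n. real (v j choose y h j)))
          = (\<Sum>h\<in>H. \<Prod>j\<in>S. c j (h j) * real (v j choose h j)) * ?R"
        by (simp add: sum_distrib_right prod.distrib mult.assoc)
      also have "(\<Sum>h\<in>H. \<Prod>j\<in>S. c j (h j) * real (v j choose h j))
          = (\<Prod>j\<in>S. \<Sum>k\<le>r. c j k * real (v j choose k))"
        unfolding H_def using fS by (subst prod_sum_PiE) auto
      also have "\<dots> = (\<Prod>j\<in>S. of_bool (v j = a j))"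
      proof (intro prod.cong refl)
        fix j assume "j \<in> S"
        then have "v j \<le> r" using tuple_system_less[OF V v] Sn by fastforce
        then show "(\<Sum>k\<le>r. c j k * real (v j choose k)) = of_bool (v j = a j)"
          unfolding c_def by (rule indicator_binomial_expansion)
      qed
      also have "\<dots> = 0"
      proof -
        have "restrict v S \<noteq> a" using a v by blast
        then obtain j where "j \<in> S" "v j \<noteq> a j"
          using a(1) by (metis PiE_restrict restrict_ext)
        then show ?thesis using fS by (auto intro!: prod_zero)
      qed
      finally show ?thesis by simp
    qed
    then have "0 = (\<Sum>v\<in>V. f v * (\<Sum>h\<in>H. (\<Prod>j\<in>S. c j (h j)) * (\<Prod>j=1..n. real (v j choose y h j))))"
      by simp
    also have "\<dots> = (\<Sum>v\<in>V. \<Sum>h\<in>H. (\<Prod>j\<in>S. c j (h j)) * (f v * (\<Prod>j=1..n. real (v j choose y h j))))"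
      by (simp add: sum_distrib_left mult.left_commute)
    also have "\<dots> = (\<Sum>h\<in>H. (\<Prod>j\<in>S. c j (h j)) * ?m (y h))"
      unfolding moment_def sum_distrib_left by (rule sum.swap)
    also have "\<dots> = (\<Prod>j\<in>S. c j (h0 j)) * ?m (y h0)"
    proof -
      have "?m (y h) = 0" if h: "h \<in> H - {h0}" for h
      proof (rule less.hyps)
        have hr: "h j \<le> r" if "j \<in> S" for j using h that by (auto simp: H_def)
        show "\<forall>j\<in>{1..n}. y h j \<le> r" using hr less.prems by (auto simp: y_def)
        have "h \<in> S \<rightarrow>\<^sub>E {..r}" "h0 \<in> S \<rightarrow>\<^sub>E {..r}" "h \<noteq> h0" using h h0 by (auto simp: H_def)
        then obtain j where "j \<in> S" "h j \<noteq> h0 j" by (meson PiE_ext)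
        then have j: "j \<in> level n r w" "j \<notin> level n r (y h)"
          using S by (auto simp: h0_def level_def y_def)
        have "level n r (y h) \<subseteq> level n r w" using S by (auto simp: level_def y_def split: if_splits)
        with j show "card (level n r (y h)) < card (level n r w)" by (intro psubset_card_mono) auto
      qed
      then have "(\<Sum>h\<in>H - {h0}. (\<Prod>j\<in>S. c j (h j)) * ?m (y h)) = 0" by (intro sum.neutral) auto
      then show ?thesis by (simp add: sum.remove[OF fH h0])
    qed
    also have "?m (y h0) = ?m w"
      using S by (intro moment_cong) (auto simp: y_def h0_def level_def)
    finally have "(\<Prod>j\<in>S. c j (h0 j)) * ?m w = 0" by simp
    \<comment> \<open>Up to sign the factors are \<open>r choose a j\<close>, nonzero since
      \<open>a j \<le> r\<close>.\<close>
    moreover have "(\<Prod>j\<in>S. c j (h0 j)) \<noteq> 0"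
      using a(1) fS by (fastforce simp: c_def h0_def binomial_eq_0_iff PiE_iff)
    ultimately show ?thesis by simp
  qed
qed

section \<open>Counting the remaining moments and concluding\<close>

lemma card_ballot_level_le:
  fixes n r s :: nat
  assumes "2 * s \<le> n"
  defines "M \<equiv> {w \<in> {1..n} \<rightarrow>\<^sub>E {..r}. card (level n r w) \<le> s \<and> ballot n (level n r w)}"
  shows "int (card M) \<le> (\<Sum>i=0..s. int r ^ (n - i) * (binom n (int i) - binom n (int i - 1)))"
proof -
  \<comment> \<open>For \<open>T \<subseteq> {1..n}\<close> these are the exponents with level set
    exactly \<open>T\<close>: off \<open>T\<close> there are \<open>r\<close> free values per
    coordinate.\<close>
  define F where "F T = (\<Pi>\<^sub>E j\<in>{1..n}. if j \<in> T then {r} else {..<r})" for T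
  have fF: "finite (F T)" for T by (auto simp: F_def intro!: finite_PiE)
  have cF: "card (F T) = r ^ (n - i)" if "T \<in> ballot_sets n i" for T i
  proof -
    have T: "T \<subseteq> {1..n}" "card T = i" using that by (auto simp: ballot_sets_def ballot_def)
    have fT: "finite T" using T finite_subset by blast
    have "card (F T) = (\<Prod>j=1..n. if j \<in> T then 1 else r)"
      unfolding F_def by (subst card_PiE) (auto intro!: prod.cong)
    also have "\<dots> = (\<Prod>j\<in>{1..n} - T. r)"
      by (intro prod.mono_neutral_cong_right) auto
    also have "\<dots> = r ^ (n - i)" using T fT by (simp add: card_Diff_subset)
    finally show ?thesis .
  qed
  have "M \<subseteq> (\<Union>i\<in>{0..s}. \<Union>T\<in>ballot_sets n i. F T)"
  proof
    fix w assume w: "w \<in> M"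
    then have "w \<in> F (level n r w)"
      by (fastforce simp: M_def F_def level_def PiE_iff)
    then show "w \<in> (\<Union>i\<in>{0..s}. \<Union>T\<in>ballot_sets n i. F T)"
      using w by (auto simp: M_def ballot_sets_def)
  qed
  then have "card M \<le> card (\<Union>i\<in>{0..s}. \<Union>T\<in>ballot_sets n i. F T)"
    by (intro card_mono) (auto simp: finite_ballot_sets fF)
  also have "\<dots> \<le> (\<Sum>i=0..s. card (\<Union>T\<in>ballot_sets n i. F T))"
    by (rule card_UN_le) auto
  also have "\<dots> \<le> (\<Sum>i=0..s. \<Sum>T\<in>ballot_sets n i. card (F T))"
    by (intro sum_mono card_UN_le finite_ballot_sets)
  also have "\<dots> = (\<Sum>i=0..s. r ^ (n - i) * card (ballot_sets n i))"
    by (simp add: cF mult.commute)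
  finally have "int (card M) \<le> (\<Sum>i=0..s. int r ^ (n - i) * int (card (ballot_sets n i)))"
    by (simp flip: of_nat_power of_nat_mult of_nat_sum)
  also have "\<dots> \<le> (\<Sum>i=0..s. int r ^ (n - i) * (binom n (int i) - binom n (int i - 1)))"
    using assms by (intro sum_mono mult_left_mono card_ballot_sets_le) auto
  finally show ?thesis .
qed

theorem theorem4:
  fixes n q d s :: nat and V :: "(nat \<Rightarrow> nat) set"
  assumes "n \<ge> 1" and "q \<ge> 2"
    and "d \<le> n * (q - 1)"
    and "real s \<le> real n / 2"
    and "tuple_system n q V"
    and "uniform_system n d V"
    and "\<And>S. S \<subseteq> {1..n} \<Longrightarrow> card S = s + 1 \<Longrightarrow> \<not> shatters q V S"
  shows "int (card V) \<le>
    (\<Sum>i=0..s. (int q - 1) ^ (n - i) * (binom n (int i) - binom n (int i - 1)))"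
proof -
  define r where "r = q - 1"
  have q: "q = Suc r" "r \<ge> 1" using assms(2) by (auto simp: r_def)
  define M where "M = {w \<in> {1..n} \<rightarrow>\<^sub>E {..r}. card (level n r w) \<le> s \<and> ballot n (level n r w)}"
  have fV: "finite V"
    using assms(5) by (auto simp: tuple_system_def intro: finite_subset finite_PiE)
  have fM: "finite M"
    by (rule finite_subset[of _ "{1..n} \<rightarrow>\<^sub>E {..r}"]) (auto simp: M_def intro: finite_PiE)
  have "card V \<le> card M"
  proof (rule ccontr)
    assume "\<not> card V \<le> card M"
    then obtain f where f: "\<exists>v\<in>V. f v \<noteq> 0"
      "\<forall>w\<in>M. (\<Sum>v\<in>V. f v * (\<Prod>j=1..n. real (v j choose w j))) = 0"
      using homogeneous_system_nontrivial_solution[OF fM fV,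
          of "\<lambda>w v. \<Prod>j=1..n. real (v j choose w j)"] by auto
    have "moment n V f w = 0" if w: "\<forall>j\<in>{1..n}. w j \<le> r" for w
    proof (rule moment_eq_0_if_not_shatters[OF assms(5)[unfolded q(1)] assms(7)[unfolded q(1)] _ w])
      fix w assume "\<forall>j\<in>{1..n}. w j \<le> r" "card (level n r w) \<le> s"
      then show "moment n V f w = 0"
      proof (rule moment_eq_0_if_ballot[OF assms(5)[unfolded q(1)] assms(6) q(2), rotated])
        fix w assume w: "\<forall>j\<in>{1..n}. w j \<le> r" "card (level n r w) \<le> s" "ballot n (level n r w)"
        \<comment> \<open>\<open>M\<close> holds extensional functions only, while moments and level
          sets see \<open>w\<close> just on \<open>{1..n}\<close>.\<close>
        have "level n r (restrict w {1..n}) = level n r w" by (auto simp: level_def)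
        then have "restrict w {1..n} \<in> M" using w by (auto simp: M_def)
        then have "moment n V f (restrict w {1..n}) = 0" using f(2) unfolding moment_def by blast
        then show "moment n V f w = 0" by (subst moment_cong[of n w "restrict w {1..n}"]) auto
      qed
    qed
    \<comment> \<open>Each tuple of \<open>V\<close> is itself an admissible exponent, so its own
      moment recovers \<open>f v\<close>.\<close>
    moreover have "\<forall>j\<in>{1..n}. v j \<le> r" if "v \<in> V" for v
      using tuple_system_less[OF assms(5) that] q by fastforce
    ultimately have "f v = 0" if "v \<in> V" for v
      using moment_self[OF fV assms(5,6) that, of f] that by simp
    with f show False by blast
  qed
  also have "int (card M) \<le> (\<Sum>i=0..s. int r ^ (n - i) * (binom n (int i) - binom n (int i - 1)))"
    unfolding M_def using assms(4) by (intro card_ballot_level_le) linarith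
  finally show ?thesis using q by simp
qed

end
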